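(* Let $n\in\mathbb N_0$ and $q,b,c,d,e,f\in\mathbb C^*$ with $|q|\ne1$. Then the terminating series $${}_8W_7\left(\frac{q^{-n}c}d;q^{-n},\frac{q^{-n}c}b,\frac{qb}{de},\frac{qb}{df},c;q,\frac{ef}b\right)$$ is equal to each of the following expressions (whenever no denominator occurring vanishes): (1) $\displaystyle\frac{\left(\frac{qb}{de},\frac{qb}{df},\frac{qb}c,\frac dc,c;q\right)_n}{\left(\frac{qb}{ce},\frac{qb}{cf},\frac{qb}d,\frac cd,d;q\right)_n}\,{}_8W_7\left(\frac{q^{-n}d}c;q^{-n},\frac{q^{-n}d}b,\frac{qb}{ce},\frac{qb}{cf},d;q,\frac{ef}b\right)$; (2) $\displaystyle\frac{\left(\frac{qb}{cd},\frac{qb}e,\frac dc,e;q\right)_n}{\left(\frac{qb}{ce},\frac{qb}d,\frac ec,d;q\right)_n}\,{}_8W_7\left(\frac{q^{-n}c}e;q^{-n},\frac{q^{-n}c}b,\frac{qb}{ed},\frac{qb}{ef},c;q,\frac{df}b\right)$; (3) $\displaystyle\frac{\left(\frac{qb}{ed},\frac{qb}{ef},\frac{qb}c,\frac dc,c;q\right)_n}{\left(\frac{qb}{ce},\frac{qb}{cf},\frac{qb}d,\frac ce,d;q\right)_n}\,{}_8W_7\left(\frac{q^{-n}e}c;q^{-n},\frac{q^{-n}e}b,\frac{qb}{cd},\frac{qb}{cf},e;q,\frac{df}b\right)$; (4) $\displaystyle\frac{\left(\frac{qb}{cd},\frac{qb}f,\frac dc,f;q\right)_n}{\left(\frac{qb}{cf},\frac{qb}d,\frac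 fc,d;q\right)_n}\,{}_8W_7\left(\frac{q^{-n}c}f;q^{-n},\frac{q^{-n}c}b,\frac{qb}{ef},\frac{qb}{df},c;q,\frac{de}b\right)$; (5) $\displaystyle\frac{\left(\frac{qb}{fd},\frac{qb}{fe},\frac{qb}c,\frac dc,c;q\right)_n}{\left(\frac{qb}{ce},\frac{qb}{cf},\frac{qb}d,\frac cf,d;q\right)_n}\,{}_8W_7\left(\frac{q^{-n}f}c;q^{-n},\frac{q^{-n}f}b,\frac{qb}{cd},\frac{qb}{ce},f;q,\frac{de}b\right)$; (6) $\displaystyle\frac{\left(\frac{qb}{ef},\frac dc;q\right)_n}{\left(\frac{qb}{cf},\frac de;q\right)_n}\,{}_8W_7\left(\frac{q^{-n}e}d;q^{-n},\frac{q^{-n}e}b,\frac{qb}{dc},\frac{qb}{df},e;q,\frac{cf}b\right)$; (7) $\displaystyle\frac{\left(\frac{qb}{dc},\frac{qb}{df},\frac{qb}e,\frac dc,e;q\right)_n}{\left(\frac{qb}{ce},\frac{qb}{cf},\frac{qb}d,\frac ed,d;q\right)_n}\,{}_8W_7\left(\frac{q^{-n}d}e;q^{-n},\frac{q^{-n}d}b,\frac{qb}{ec},\frac{qb}{ef},d;q,\frac{cf}b\right)$; (8) $\displaystyle\frac{\left(\frac{qb}{ef},\frac dc;q\right)_n}{\left(\frac{qb}{ce},\frac df;q\right)_n}\,{}_8W_7\left(\frac{q^{-n}f}d;q^{-n},\frac{q^{-n}f}b,\frac{qb}{dc},\frac{qb}{de},f;q,\frac{ce}b\right)$; (9) $\displaystyle\frac{\left(\frac{qb}{de},\frac{qb}{dc},\frac{qb}f,\frac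 dc,f;q\right)_n}{\left(\frac{qb}{ce},\frac{qb}{cf},\frac{qb}d,\frac fd,d;q\right)_n}\,{}_8W_7\left(\frac{q^{-n}d}f;q^{-n},\frac{q^{-n}d}b,\frac{qb}{fc},\frac{qb}{fe},d;q,\frac{ce}b\right)$; (10) $\displaystyle\frac{\left(\frac{qb}{ed},\frac{qb}f,\frac dc,f;q\right)_n}{\left(\frac{qb}{cf},\frac{qb}d,\frac fe,d;q\right)_n}\,{}_8W_7\left(\frac{q^{-n}e}f;q^{-n},\frac{q^{-n}e}b,\frac{qb}{fc},\frac{qb}{fd},e;q,\frac{cd}b\right)$; (11) $\displaystyle\frac{\left(\frac{qb}{df},\frac{qb}e,\frac dc,e;q\right)_n}{\left(\frac{qb}{ce},\frac{qb}d,\frac ef,d;q\right)_n}\,{}_8W_7\left(\frac{q^{-n}f}e;q^{-n},\frac{q^{-n}f}b,\frac{qb}{ec},\frac{qb}{ed},f;q,\frac{cd}b\right)$.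
   Context: $\mathbb N_0=\{0,1,2,\ldots\}$, $\mathbb C^*=\mathbb C\setminus\{0\}$; $e$ is a parameter, not Euler's number. The $q$-Pochhammer symbol is $(a;q)_n=(1-a)(1-aq)\cdots(1-aq^{n-1})$ (empty product equal to $1$), and $(a_1,\ldots,a_k;q)_n=(a_1;q)_n\cdots(a_k;q)_n$. The terminating very-well poised series is $${}_8W_7(b;q^{-n},c,d,e,f;q,z)=\sum_{k=0}^n\frac{\left(b,q\sqrt b,-q\sqrt b,q^{-n},c,d,e,f;q\right)_k}{\left(q,\sqrt b,-\sqrt b,q^{n+1}b,\frac{qb}c,\frac{qb}d,\frac{qb}e,\frac{qb}f;q\right)_k}z^k,$$ where $\sqrt b$ is either square root of $b$. Standing convention: denominator parameters of a terminating series avoid $\{q^{-k}:0\le k\le n-1\}$, so that no denominator vanishes. *)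

theory Defs
  imports Complex_Main
begin

definition qpoch :: "complex \<Rightarrow> complex \<Rightarrow> nat \<Rightarrow> complex" where
  "qpoch a q n = (\<Prod>k<n. 1 - a * q ^ k)"

definition qpochs :: "complex list \<Rightarrow> complex \<Rightarrow> nat \<Rightarrow> complex" where
  "qpochs as q n = (\<Prod>a\<leftarrow>as. qpoch a q n)"

text \<open>
  Numerator and denominator parameters of the terminating series
  8W7(b; q^(-n), c, d, e, f; q, z), where s is a square root of b.
\<close>

definition W87_num ::
  "complex \<Rightarrow> complex \<Rightarrow> nat \<Rightarrow> complex \<Rightarrow> complex \<Rightarrow> complex \<Rightarrow> complex \<Rightarrow> complex \<Rightarrow> complex list"
where
  "W87_num s b n c d e f q = [b, q * s, - q * s, q powi (- int n), c, d, e, f]"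

definition W87_den ::
  "complex \<Rightarrow> complex \<Rightarrow> nat \<Rightarrow> complex \<Rightarrow> complex \<Rightarrow> complex \<Rightarrow> complex \<Rightarrow> complex \<Rightarrow> complex list"
where
  "W87_den s b n c d e f q =
    [q, s, - s, q ^ (n + 1) * b, q * b / c, q * b / d, q * b / e, q * b / f]"

text \<open>
  The principal square root is used; by \<open>W87_any_sqrt\<close> and
  \<open>W87_admissible_any_sqrt\<close> below the choice does not matter.
  The parameter q^(-n) enters only through n.
\<close>

definition W87 ::
  "complex \<Rightarrow> nat \<Rightarrow> complex \<Rightarrow> complex \<Rightarrow> complex \<Rightarrow> complex \<Rightarrow> complex \<Rightarrow> complex \<Rightarrow> complex"
where
  "W87 b n c d e f q z =
    (\<Sum>k\<le>n. qpochs (W87_num (csqrt b) b n c d e f q) q k /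
            qpochs (W87_den (csqrt b) b n c d e f q) q k * z ^ k)"

text \<open>
  No denominator of the series vanishes: its denominator parameters avoid
  q^(-k) for k < n. HOL's convention x / 0 = 0 would otherwise give the
  series an unintended value.
\<close>

definition W87_admissible ::
  "complex \<Rightarrow> nat \<Rightarrow> complex \<Rightarrow> complex \<Rightarrow> complex \<Rightarrow> complex \<Rightarrow> complex \<Rightarrow> bool"
where
  "W87_admissible b n c d e f q \<longleftrightarrow>
    (\<forall>x \<in> set (W87_den (csqrt b) b n c d e f q). \<forall>k<n. x \<noteq> q powi (- int k))"

lemma sqrt_cases:
  fixes s b :: complex
  assumes "s ^ 2 = b"
  shows "s = csqrt b \<or> s = - csqrt b"
  using assms by (metis power2_csqrt power2_eq_iff)

lemma W87_any_sqrt: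
  assumes "s ^ 2 = b"
  shows "W87 b n c d e f q z =
    (\<Sum>k\<le>n. qpochs (W87_num s b n c d e f q) q k /
            qpochs (W87_den s b n c d e f q) q k * z ^ k)"
  using sqrt_cases[OF assms]
  by (auto simp: W87_def W87_num_def W87_den_def qpochs_def mult_ac)

lemma W87_admissible_any_sqrt:
  assumes "s ^ 2 = b"
  shows "W87_admissible b n c d e f q \<longleftrightarrow>
    (\<forall>x \<in> set (W87_den s b n c d e f q). \<forall>k<n. x \<noteq> q powi (- int k))"
  using sqrt_cases[OF assms] by (auto simp: W87_admissible_def W87_den_def)

lemma W87_admissible_imp_nonzero:
  assumes "q \<noteq> 0" "W87_admissible b n c d e f q" "k \<le> n"
  shows "qpochs (W87_den (csqrt b) b n c d e f q) q k \<noteq> 0"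
proof -
  have "qpoch x q k \<noteq> 0" if x: "x \<in> set (W87_den (csqrt b) b n c d e f q)" for x
  proof -
    have "x * q ^ j \<noteq> 1" if "j < k" for j
    proof
      assume "x * q ^ j = 1"
      then have "x = q powi (- int j)"
        using assms(1) by (simp add: power_int_minus field_simps)
      moreover have "j < n"
        using that assms(3) by simp
      ultimately show False
        using assms(2) x unfolding W87_admissible_def by blast
    qed
    then show ?thesis by (auto simp: qpoch_def)
  qed
  then show ?thesis by (auto simp: qpochs_def prod_list_zero_iff)
qed

end

theory Submission
  imports Defs
begin

text \<open>
  Write \<open>\<beta> = q b\<close> and \<open>y = d / c\<close>. All twelve series have the form \<open>W(c,d;e,f)\<close>, where an
  ordered pair is singled out from the four parameters, so the corollary says that a suitable
  multiple of \<open>W(c,d;e,f)\<close> is symmetric in \<open>c, d, e, f\<close>. That multiple is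
  \<open>(d, \<beta>/d, \<beta>/(ce), \<beta>/(cf); q)\<^sub>n W(c,d;e,f) / (d/c; q)\<^sub>n\<close>; it is an Askey-Wilson polynomial.

  The classical route is Watson's transformation to a balanced 4-phi-3 series followed by Sears'
  transformation. Here the symmetry is read off from a recurrence instead. Clearing denominators
  turns \<open>W(c,d;e,f)\<close> into the sum \<open>vwp_sum\<close> (lemma \<open>W87_eq_vwp_sum\<close>), in which the only
  denominators left depend on \<open>c / d\<close>. The simultaneous shift
  \<open>(c, d, e, f, \<beta>) \<mapsto> (q c, q d, q e, q f, q\<^sup>2 \<beta>)\<close> fixes \<open>c / d\<close> and every
  quotient \<open>\<beta> / (d e)\<close>, and the sum for \<open>n + 1\<close> is a combination of the sum for
  \<open>n\<close> and the shifted sum for \<open>n\<close> (lemma \<open>vwp_sum_rec\<close>; this is the raising operator of the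
  Askey-Wilson polynomials). Apart from a factor depending on \<open>c / d\<close> alone, the coefficients
  are symmetric in \<open>c, d, e, f\<close>. Hence \<open>vwp_sum\<close> equals \<open>(d/c; q)\<^sub>n\<^sub>+\<^sub>1\<close> times a function \<open>sym_rec\<close>
  defined by a manifestly symmetric recursion.

  The recursion for \<open>sym_rec\<close> divides by \<open>1 - \<beta> q\<^sup>n\<close>, so it excludes finitely many \<open>\<beta>\<close>.
  These are recovered by continuity in \<open>\<beta>\<close>, in a form where \<open>sym_rec\<close> has been eliminated
  and which stays meaningful when \<open>(d/c; q)\<^sub>n = 0\<close> (lemma \<open>vwp_sum_symmetric\<close>).
\<close>

section \<open>Shifted factorials and q-binomial coefficients\<close>

lemma qpoch_0 [simp]: "qpoch a q 0 = 1" by (simp add: qpoch_def)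
lemma qpoch_Suc: "qpoch a q (Suc n) = qpoch a q n * (1 - a * q ^ n)" by (simp add: qpoch_def)
lemma qpoch_add: "qpoch a q (m + n) = qpoch a q m * qpoch (a * q ^ m) q n"
  by (induction n) (simp_all add: qpoch_Suc power_add mult_ac)
lemma qpoch_Suc_left: "qpoch a q (Suc n) = (1 - a) * qpoch (a * q) q n"
  using qpoch_add[of a q 1 n] by (simp add: qpoch_Suc)
lemma qpoch_shift: "(1 - a) * qpoch (a * q) q n = qpoch a q n * (1 - a * q ^ n)"
  by (metis qpoch_Suc qpoch_Suc_left)
lemma qpoch_nonzero_iff: "qpoch a q n \<noteq> 0 \<longleftrightarrow> (\<forall>k<n. a * q ^ k \<noteq> 1)"
  by (auto simp: qpoch_def)
lemma qpoch_nonzero_le: "qpoch a q n \<noteq> 0 \<Longrightarrow> k \<le> n \<Longrightarrow> qpoch a q k \<noteq> 0"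
  by (auto simp: qpoch_nonzero_iff)

lemma qpoch_q_nonzero:
  assumes "norm q \<noteq> 1"
  shows "qpoch q q n \<noteq> 0"
proof -
  have "q ^ Suc k \<noteq> 1" for k
  proof
    assume "q ^ Suc k = 1"
    then have "norm q ^ Suc k = 1" by (metis norm_one norm_power)
    then show False using assms by (metis norm_ge_zero power_eq_1_iff nat.simps(3) abs_norm_cancel real_norm_def)
  qed
  then show ?thesis by (simp add: qpoch_nonzero_iff)
qed

text \<open>
  The factors are matched in reverse order, using
  \<open>1 - x = - x (1 - 1 / x)\<close>. This moves between parameters containing \<open>q\<^sup>-\<^sup>n\<close> and
  parameters free of it. The product of powers of \<open>q\<close> on the right does not depend on
  \<open>z\<close>, so it drops out of quotients with equally many reflected factors.
\<close>
lemma qpoch_reflect: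
  assumes "q \<noteq> 0" "z \<noteq> 0"
  shows "qpoch (q ^ (m + 1) / z) q k =
    (\<Prod>j<k. q ^ (m + k - j)) * (- 1 / z) ^ k * qpoch (q powi (- int (m + k)) * z) q k"
proof -
  have "qpoch (q ^ (m + 1) / z) q k = (\<Prod>j<k. 1 - q ^ (m + k - j) / z)"
    unfolding qpoch_def
  proof (rule prod.reindex_bij_witness[of _ "\<lambda>j. k - 1 - j" "\<lambda>j. k - 1 - j"])
    fix j assume "j \<in> {..<k}"
    then have "m + k - (k - 1 - j) = m + 1 + j" by simp
    then show "1 - q ^ (m + k - (k - 1 - j)) / z = 1 - q ^ (m + 1) / z * q ^ j"
      by (simp add: power_add)
  qed auto
  also have "\<dots> = (\<Prod>j<k. q ^ (m + k - j) * ((- 1 / z) * (1 - q powi (- int (m + k)) * z * q ^ j)))"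
  proof (rule prod.cong)
    fix j assume "j \<in> {..<k}"
    then have "q ^ (m + k) = q ^ (m + k - j) * q ^ j" by (simp flip: power_add)
    then have "q ^ (m + k - j) * q powi (- int (m + k)) * q ^ j = 1"
      using assms(1) by (simp add: power_int_minus power_int_of_nat del: of_nat_add) (simp add: field_simps)
    then have "z * (q ^ (m + k - j) * q powi (- int (m + k)) * q ^ j) = z" by simp
    then show "1 - q ^ (m + k - j) / z =
        q ^ (m + k - j) * ((- 1 / z) * (1 - q powi (- int (m + k)) * z * q ^ j))"
      using assms(2) by (simp add: divide_simps) (simp add: algebra_simps)
  qed simp
  also have "\<dots> = (\<Prod>j<k. q ^ (m + k - j)) * (- 1 / z) ^ k * qpoch (q powi (- int (m + k)) * z) q k"
    by (simp only: qpoch_def prod.distrib prod_constant card_lessThan mult.assoc)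
  finally show ?thesis .
qed

definition qbinom :: "complex \<Rightarrow> nat \<Rightarrow> nat \<Rightarrow> complex" where
  "qbinom q n k = (if k \<le> n then qpoch q q n / (qpoch q q k * qpoch q q (n - k)) else 0)"

text \<open>
  Both forms of the q-Pascal rule are needed at once: each contributes one of the two coefficients
  produced by the recurrence below.
\<close>
lemma qbinom_pascal:
  assumes "norm q \<noteq> 1" "k \<le> n"
  shows "qbinom q (Suc n) (Suc k) = qbinom q n k + q ^ Suc k * qbinom q n (Suc k)"
    and "qbinom q (Suc n) (Suc k) = q ^ (n - k) * qbinom q n k + qbinom q n (Suc k)"
proof -
  note nz = qpoch_q_nonzero[OF assms(1)]
  have "qbinom q (Suc n) (Suc k) = qbinom q n k + q ^ Suc k * qbinom q n (Suc k) \<and>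
        qbinom q (Suc n) (Suc k) = q ^ (n - k) * qbinom q n k + qbinom q n (Suc k)"
  proof (cases "k = n")
    case True
    then show ?thesis by (simp add: qbinom_def nz)
  next
    case False
    then obtain m where n: "n = Suc (k + m)" using assms(2) less_imp_Suc_add by (metis le_neq_implies_less)
    have a: "1 - q * q ^ k \<noteq> 0" "1 - q * q ^ m \<noteq> 0"
      using nz[of "Suc k"] nz[of "Suc m"] by (auto simp: qpoch_Suc)
    show ?thesis
      using nz[of k] nz[of m] a
      by (simp add: n qbinom_def Suc_diff_le divide_simps qpoch_Suc[of _ _ k] qpoch_Suc[of _ _ m]
            qpoch_Suc[of _ _ "Suc (k + m)"])
         (simp add: algebra_simps power_add)
  qed
  then show "qbinom q (Suc n) (Suc k) = qbinom q n k + q ^ Suc k * qbinom q n (Suc k)"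
    "qbinom q (Suc n) (Suc k) = q ^ (n - k) * qbinom q n k + qbinom q n (Suc k)" by auto
qed

section \<open>The series with its denominators cleared\<close>

text \<open>
  The part of the \<open>k\<close>-th summand that depends on more than \<open>y = d / c\<close>, with
  \<open>m = n - k\<close>. Exchanging \<open>c\<close> with \<open>d\<close> and \<open>k\<close> with \<open>m\<close> preserves it:
  it is reversal of the order of summation.
\<close>
definition vwp_factor where
  "vwp_factor q \<beta> c d e f k m =
     qpoch c q k * qpoch (\<beta> / (d * e)) q k * qpoch (\<beta> / (d * f)) q k * qpoch (q ^ m * \<beta> / c) q k *
     (qpoch d q m * qpoch (\<beta> / (c * e)) q m * qpoch (\<beta> / (c * f)) q m * qpoch (q ^ k * \<beta> / d) q m)"

text \<open>
  The part that depends on \<open>y\<close> only, up to the very-well-poised factor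
  \<open>q\<^sup>k - y q\<^sup>n\<^sup>-\<^sup>k\<close>. It stems from the base of the series and the parameters tied to it:
  \<open>q / y = q c / d\<close> is \<open>q\<^sup>n\<^sup>+\<^sup>1\<close> times the base of the series.
\<close>
definition vwp_weight where
  "vwp_weight q y n k = qbinom q n k * qpoch (q ^ (n - k + 1) * y) q k / qpoch (q / y) q k"

text \<open>
  This is \<open>1 - y q\<^sup>n\<close> times the cleared series. With the extra factor the summand has one
  shape for all \<open>k\<close>; without it, shifted factorials of length \<open>k - 1\<close> appear and
  \<open>k = 0\<close> has to be treated apart.
\<close>
definition vwp_sum where
  "vwp_sum q n \<beta> c d e f = (\<Sum>k\<le>n. (q ^ k - d / c * q ^ (n - k)) *
      vwp_weight q (d / c) n k * vwp_factor q \<beta> c d e f k (n - k))"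

text \<open>
  Up to normalisation, the Askey-Wilson polynomial of degree \<open>n\<close> with the parameters
  \<open>c/z, d/z, e/z, f/z\<close> at \<open>(z + 1/z) / 2\<close>, where \<open>z\<^sup>2 = \<beta> q\<^sup>n\<^sup>-\<^sup>1\<close>. The recursion is its raising
  operator. It serves as the definition because the symmetry is visible in it.
\<close>
fun sym_rec where
  "sym_rec q 0 \<beta> c d e f = (1::complex)"
| "sym_rec q (Suc n) \<beta> c d e f =
    ((1 - \<beta> * q ^ n / c) * (1 - \<beta> * q ^ n / d) * (1 - \<beta> * q ^ n / e) * (1 - \<beta> * q ^ n / f) * sym_rec q n \<beta> c d e f
     - \<beta>\<^sup>2 * q ^ n / (c * d * e * f) * ((1 - c) * (1 - d) * (1 - e) * (1 - f)) *
       sym_rec q n (q\<^sup>2 * \<beta>) (q * c) (q * d) (q * e) (q * f)) / (1 - \<beta> * q ^ n)"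

section \<open>The raising recurrence\<close>

text \<open>
  The four points \<open>1, \<tau>, t3, t4\<close> admit one linear relation between the values of a
  quadratic polynomial, namely the vanishing of its third divided difference. Here the polynomial
  is \<open>(1 - t x) (1 - t y)\<close> and the relation is multiplied out.
\<close>
lemma lagrange4:
  fixes t3 t4 \<tau> x y :: complex
  defines "g \<equiv> \<lambda>t. (1 - t * x) * (1 - t * y)"
  shows "(t3 - t4) * ((\<tau> - t3) * (\<tau> - t4) * g 1 - (1 - t3) * (1 - t4) * g \<tau>) =
     (1 - \<tau>) * ((1 - t3) * (\<tau> - t3) * g t4 - (1 - t4) * (\<tau> - t4) * g t3)"
  unfolding g_def by algebra

text \<open>
  After the common factor \<open>K\<close> and elementary factors free of \<open>e\<close> and \<open>f\<close> are
  removed, the four products differ only in the value at which \<open>g t = (1 - t / e) (1 - t / f)\<close> is taken: at \<open>\<tau>\<close> and \<open>1\<close> for the plain and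
  the shifted product of level \<open>n = k + m\<close>, and at \<open>t3\<close> and \<open>t4\<close> for the two
  products of level \<open>n + 1\<close>. The relation between these four values has exactly the
  coefficients needed, because \<open>\<tau> - t3\<close> and \<open>\<tau> - t4\<close> are multiples of
  \<open>1 - c q\<^sup>k\<close> and \<open>1 - d q\<^sup>m\<close>, and because \<open>t3 t4\<close> depends on \<open>k + m\<close> only.
\<close>
lemma vwp_factor_rec:
  fixes k m :: nat and \<beta> c d e f q :: complex
  assumes "q \<noteq> 0" "c \<noteq> 0" "d \<noteq> 0" "e \<noteq> 0" "f \<noteq> 0" "\<beta> \<noteq> 0"
  defines "\<tau> \<equiv> \<beta> * q ^ (k + m)"
  shows "(q ^ k - d / c * q ^ m) *
     ((1 - \<tau> / c) * (1 - \<tau> / d) * (1 - \<tau> / e) * (1 - \<tau> / f) * vwp_factor q \<beta> c d e f k m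
       - \<beta>\<^sup>2 * q ^ (k + m) / (c * d * e * f) * ((1 - c) * (1 - d) * (1 - e) * (1 - f)) *
         vwp_factor q (q\<^sup>2 * \<beta>) (q * c) (q * d) (q * e) (q * f) k m) =
     (1 - \<tau>) * (q ^ k * vwp_factor q \<beta> c d e f k (Suc m) - d / c * q ^ m * vwp_factor q \<beta> c d e f (Suc k) m)"
proof -
  define t3 t4 where t: "t3 = \<beta> * q ^ m / c" "t4 = \<beta> * q ^ k / d"
  define g where "g = (\<lambda>t. (1 - t * (1 / e)) * (1 - t * (1 / f)))"
  define K where "K = qpoch c q k * qpoch (\<beta> / (d * e)) q k * qpoch (\<beta> / (d * f)) q k * qpoch (t3 * q) q k *
     (qpoch d q m * qpoch (\<beta> / (c * e)) q m * qpoch (\<beta> / (c * f)) q m * qpoch (t4 * q) q m)"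
  have t3k: "t3 * q ^ k = \<tau> / c" and t4m: "t4 * q ^ m = \<tau> / d"
    by (simp_all add: t \<tau>_def power_add)
  have s3: "qpoch t3 q k * (1 - \<tau> / c) = (1 - t3) * qpoch (t3 * q) q k"
    using qpoch_shift[of t3 q k] by (simp add: t3k)
  have s4: "qpoch t4 q m * (1 - \<tau> / d) = (1 - t4) * qpoch (t4 * q) q m"
    using qpoch_shift[of t4 q m] by (simp add: t4m)
  have sc: "(1 - c) * qpoch (q * c) q k = qpoch c q k * (1 - c * q ^ k)"
    using qpoch_shift[of c q k] by (simp add: mult.commute)
  have sd: "(1 - d) * qpoch (q * d) q m = qpoch d q m * (1 - d * q ^ m)"
    using qpoch_shift[of d q m] by (simp add: mult.commute)
  have P0: "(1 - \<tau> / c) * (1 - \<tau> / d) * vwp_factor q \<beta> c d e f k m = (1 - t3) * (1 - t4) * K"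
  proof -
    have "(1 - \<tau> / c) * (1 - \<tau> / d) * vwp_factor q \<beta> c d e f k m =
       qpoch c q k * qpoch (\<beta> / (d * e)) q k * qpoch (\<beta> / (d * f)) q k * (qpoch t3 q k * (1 - \<tau> / c)) *
     (qpoch d q m * qpoch (\<beta> / (c * e)) q m * qpoch (\<beta> / (c * f)) q m * (qpoch t4 q m * (1 - \<tau> / d)))"
      by (simp add: vwp_factor_def t mult_ac)
    then show ?thesis unfolding s3 s4 by (simp add: K_def mult_ac)
  qed
  have Ps: "(1 - c) * (1 - d) * vwp_factor q (q\<^sup>2 * \<beta>) (q * c) (q * d) (q * e) (q * f) k m =
      (1 - c * q ^ k) * (1 - d * q ^ m) * K"
  proof -
    have h1: "q\<^sup>2 * \<beta> / (q * u * (q * v)) = \<beta> / (u * v)" for u v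
      using assms(1) by (simp add: power2_eq_square)
    have h2: "q ^ m * (q\<^sup>2 * \<beta>) / (q * c) = t3 * q" "q ^ k * (q\<^sup>2 * \<beta>) / (q * d) = t4 * q"
      using assms(1) by (simp_all add: t power2_eq_square mult_ac)
    have "(1 - c) * (1 - d) * vwp_factor q (q\<^sup>2 * \<beta>) (q * c) (q * d) (q * e) (q * f) k m =
       ((1 - c) * qpoch (q * c) q k) * qpoch (\<beta> / (d * e)) q k * qpoch (\<beta> / (d * f)) q k * qpoch (t3 * q) q k *
     (((1 - d) * qpoch (q * d) q m) * qpoch (\<beta> / (c * e)) q m * qpoch (\<beta> / (c * f)) q m * qpoch (t4 * q) q m)"
      unfolding vwp_factor_def h1 h2 by (simp only: mult_ac)
    then show ?thesis unfolding sc sd by (simp add: K_def mult_ac)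
  qed
  have P1: "vwp_factor q \<beta> c d e f k (Suc m) = (1 - d * q ^ m) * (1 - t4) * g t3 * K"
  proof -
    have "q ^ Suc m * \<beta> / c = t3 * q" "q ^ k * \<beta> / d = t4" by (simp_all add: t mult_ac)
    moreover have "g t3 = (1 - \<beta> / (c * e) * q ^ m) * (1 - \<beta> / (c * f) * q ^ m)"
      by (simp add: g_def t mult_ac)
    ultimately show ?thesis unfolding vwp_factor_def
      by (simp add: qpoch_Suc_left[of t4] qpoch_Suc[of d] qpoch_Suc[of "\<beta> / (c * _)"] K_def mult_ac)
  qed
  have P2: "vwp_factor q \<beta> c d e f (Suc k) m = (1 - c * q ^ k) * (1 - t3) * g t4 * K"
  proof -
    have "q ^ Suc k * \<beta> / d = t4 * q" "q ^ m * \<beta> / c = t3" by (simp_all add: t mult_ac)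
    moreover have "g t4 = (1 - \<beta> / (d * e) * q ^ k) * (1 - \<beta> / (d * f) * q ^ k)"
      by (simp add: g_def t mult_ac)
    ultimately show ?thesis unfolding vwp_factor_def
      by (simp add: qpoch_Suc_left[of t3] qpoch_Suc[of c] qpoch_Suc[of "\<beta> / (d * _)"] K_def mult_ac)
  qed
  have d3: "\<tau> - t3 = - t3 * (1 - c * q ^ k)" and d4: "\<tau> - t4 = - t4 * (1 - d * q ^ m)"
    using assms(2,3) by (simp_all add: t \<tau>_def power_add field_simps)
  have tt: "\<beta>\<^sup>2 * q ^ (k + m) / (c * d * e * f) * ((1 - e) * (1 - f)) = t3 * t4 * g 1"
    using assms by (simp add: t g_def power_add power2_eq_square field_simps)
  have g\<tau>: "(1 - \<tau> / e) * (1 - \<tau> / f) = g \<tau>" by (simp add: g_def)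
  have L: "(t3 - t4) * (t3 * t4 * (1 - c * q ^ k) * (1 - d * q ^ m) * g 1 - (1 - t3) * (1 - t4) * g \<tau>) =
     (1 - \<tau>) * ((1 - t4) * t4 * (1 - d * q ^ m) * g t3 - (1 - t3) * t3 * (1 - c * q ^ k) * g t4)"
  proof -
    have "(t3 - t4) * ((\<tau> - t3) * (\<tau> - t4) * g 1 - (1 - t3) * (1 - t4) * g \<tau>) =
       (1 - \<tau>) * ((1 - t3) * (\<tau> - t3) * g t4 - (1 - t4) * (\<tau> - t4) * g t3)"
      unfolding g_def by (rule lagrange4)
    then show ?thesis unfolding d3 d4 by (simp add: mult_ac)
  qed
  define D where "D = d / \<beta>"
  have r: "q ^ k - d / c * q ^ m = - D * (t3 - t4)" "q ^ k = D * t4" "d / c * q ^ m = D * t3"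
    using assms by (simp_all add: D_def t field_simps)
  have "(q ^ k - d / c * q ^ m) *
     ((1 - \<tau> / c) * (1 - \<tau> / d) * (1 - \<tau> / e) * (1 - \<tau> / f) * vwp_factor q \<beta> c d e f k m
       - \<beta>\<^sup>2 * q ^ (k + m) / (c * d * e * f) * ((1 - c) * (1 - d) * (1 - e) * (1 - f)) *
         vwp_factor q (q\<^sup>2 * \<beta>) (q * c) (q * d) (q * e) (q * f) k m)
    = - D * (t3 - t4) *
     (((1 - \<tau> / e) * (1 - \<tau> / f)) * ((1 - \<tau> / c) * (1 - \<tau> / d) * vwp_factor q \<beta> c d e f k m)
       - (\<beta>\<^sup>2 * q ^ (k + m) / (c * d * e * f) * ((1 - e) * (1 - f))) *
         ((1 - c) * (1 - d) * vwp_factor q (q\<^sup>2 * \<beta>) (q * c) (q * d) (q * e) (q * f) k m))"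
    unfolding r(1) by (simp add: mult_ac)
  also have "\<dots> = D * K * ((t3 - t4) * (t3 * t4 * (1 - c * q ^ k) * (1 - d * q ^ m) * g 1 - (1 - t3) * (1 - t4) * g \<tau>))"
    unfolding P0 Ps tt g\<tau> by algebra
  also have "\<dots> = (1 - \<tau>) * ((D * t4) * vwp_factor q \<beta> c d e f k (Suc m) - (D * t3) * vwp_factor q \<beta> c d e f (Suc k) m)"
    unfolding L P1 P2 by algebra
  finally show ?thesis unfolding r(2,3)[symmetric] .
qed

text \<open>
  This says that the coefficients of the product with index \<open>k + 1\<close>, collected from the
  two neighbouring summands of level \<open>n\<close>, add up to the coefficient at level \<open>n + 1\<close>.
  Cancelling the common shifted factorials leaves a combination of the two q-Pascal rules.
\<close>
lemma vwp_weight_rec: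
  assumes "norm q \<noteq> 1" "y \<noteq> 0" "qpoch (q / y) q (Suc n) \<noteq> 0" "k \<le> n"
  shows "(1 - q ^ Suc n * y) * (q ^ Suc k * vwp_weight q y n (Suc k) - y * q ^ (n - k) * vwp_weight q y n k)
     = (q ^ Suc k - y * q ^ (n - k)) * vwp_weight q y (Suc n) (Suc k)"
proof -
  obtain m where n: "n = k + m" using assms(4) le_Suc_ex by blast
  have nz: "qpoch (q / y) q k \<noteq> 0" "1 - q / y * q ^ k \<noteq> 0"
    using qpoch_nonzero_le[OF assms(3), of "Suc k"] assms(4) by (auto simp: qpoch_Suc)
  define u where "u = 1 - q / y * q ^ k"
  define A where "A = qpoch (q ^ Suc m * y) q k / (qpoch (q / y) q k * u)"
  have "u \<noteq> 0" using nz(2) by (simp only: u_def) simp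
  then have w1: "vwp_weight q y n k = qbinom q n k * (1 - q / y * q ^ k) * A"
    unfolding u_def[symmetric] by (simp add: vwp_weight_def A_def n)
  have w3: "vwp_weight q y (Suc n) (Suc k) = qbinom q (Suc n) (Suc k) * (1 - q ^ Suc n * y) * A"
    by (simp add: vwp_weight_def A_def u_def n qpoch_Suc[of _ _ k] power_add mult_ac)
  have w2: "vwp_weight q y n (Suc k) = qbinom q n (Suc k) * (1 - q ^ m * y) * A"
  proof (cases m)
    case 0
    then show ?thesis by (simp add: vwp_weight_def n qbinom_def)
  next
    case (Suc i)
    then show ?thesis
      by (simp add: vwp_weight_def A_def u_def n qpoch_Suc[of "q/y"] qpoch_Suc_left[of "q * (y * q ^ i)"] mult_ac)
  qed
  have p: "qbinom q (Suc n) (Suc k) = qbinom q n k + q ^ Suc k * qbinom q n (Suc k)"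
    "qbinom q (Suc n) (Suc k) = q ^ m * qbinom q n k + qbinom q n (Suc k)"
    using qbinom_pascal[OF assms(1,4)] n by simp_all
  have "q ^ Suc k * (qbinom q n (Suc k) * (1 - q ^ m * y)) - y * q ^ m * (qbinom q n k * (1 - q / y * q ^ k))
     = q ^ Suc k * (q ^ m * qbinom q n k + qbinom q n (Suc k)) - y * q ^ m * (qbinom q n k + q ^ Suc k * qbinom q n (Suc k))"
    using assms(2) by (simp add: field_simps)
  also have "\<dots> = (q ^ Suc k - y * q ^ m) * qbinom q (Suc n) (Suc k)"
    unfolding p[symmetric] by (simp add: algebra_simps)
  finally have main: "q ^ Suc k * (qbinom q n (Suc k) * (1 - q ^ m * y)) - y * q ^ m * (qbinom q n k * (1 - q / y * q ^ k))
     = (q ^ Suc k - y * q ^ m) * qbinom q (Suc n) (Suc k)" .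
  have "(1 - q ^ Suc n * y) * (q ^ Suc k * vwp_weight q y n (Suc k) - y * q ^ m * vwp_weight q y n k) =
     (1 - q ^ Suc n * y) * A * (q ^ Suc k * (qbinom q n (Suc k) * (1 - q ^ m * y)) - y * q ^ m * (qbinom q n k * (1 - q / y * q ^ k)))"
    unfolding w1 w2 by (simp only: ring_distribs mult_ac)
  also have "\<dots> = (q ^ Suc k - y * q ^ m) * vwp_weight q y (Suc n) (Suc k)"
    unfolding main w3 by (simp only: mult_ac)
  finally show ?thesis by (simp add: n)
qed

text \<open>
  Each summand of level \<open>n\<close> splits into two consecutive products of level \<open>n + 1\<close> by
  \<open>vwp_factor_rec\<close>; regrouping by product and applying \<open>vwp_weight_rec\<close> gives the sum
  of level \<open>n + 1\<close>.
\<close>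
lemma vwp_sum_rec:
  fixes n :: nat and \<beta> c d e f q :: complex
  assumes "norm q \<noteq> 1" "q \<noteq> 0" "c \<noteq> 0" "d \<noteq> 0" "e \<noteq> 0" "f \<noteq> 0" "\<beta> \<noteq> 0"
    and "qpoch (q / (d / c)) q (Suc n) \<noteq> 0"
  defines "\<tau> \<equiv> \<beta> * q ^ n"
  shows "(1 - \<tau>) * vwp_sum q (Suc n) \<beta> c d e f = (1 - q ^ Suc n * (d / c)) *
     ((1 - \<tau> / c) * (1 - \<tau> / d) * (1 - \<tau> / e) * (1 - \<tau> / f) * vwp_sum q n \<beta> c d e f
       - \<beta>\<^sup>2 * q ^ n / (c * d * e * f) * ((1 - c) * (1 - d) * (1 - e) * (1 - f)) *
         vwp_sum q n (q\<^sup>2 * \<beta>) (q * c) (q * d) (q * e) (q * f))"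
proof -
  define y where "y = d / c"
  have y: "y \<noteq> 0" "q * d / (q * c) = y" using assms by (simp_all add: y_def)
  define Y where "Y = (1 - \<tau> / c) * (1 - \<tau> / d) * (1 - \<tau> / e) * (1 - \<tau> / f)"
  define X where "X = \<beta>\<^sup>2 * q ^ n / (c * d * e * f) * ((1 - c) * (1 - d) * (1 - e) * (1 - f))"
  define p where "p k = vwp_factor q \<beta> c d e f k (Suc n - k)" for k
  define w where "w k = vwp_weight q y n k" for k
  have termwise: "Y * ((q ^ k - y * q ^ (n - k)) * w k * vwp_factor q \<beta> c d e f k (n - k)) -
      X * ((q ^ k - y * q ^ (n - k)) * w k * vwp_factor q (q\<^sup>2 * \<beta>) (q * c) (q * d) (q * e) (q * f) k (n - k)) =
      (1 - \<tau>) * (q ^ k * w k * p k - y * q ^ (n - k) * w k * p (Suc k))" if "k \<le> n" for k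
  proof -
    have "(q ^ k - y * q ^ (n - k)) * (Y * vwp_factor q \<beta> c d e f k (n - k) -
      X * vwp_factor q (q\<^sup>2 * \<beta>) (q * c) (q * d) (q * e) (q * f) k (n - k)) =
      (1 - \<tau>) * (q ^ k * p k - y * q ^ (n - k) * p (Suc k))"
      using vwp_factor_rec[OF assms(2-7), of k "n - k"] that
      by (simp add: X_def Y_def \<tau>_def y_def p_def Suc_diff_le)
    from arg_cong[OF this, of "\<lambda>t. w k * t"] show ?thesis by (simp only: ring_distribs mult_ac)
  qed
  have last: "w (Suc n) = 0" by (simp add: w_def vwp_weight_def qbinom_def)
  have "Y * vwp_sum q n \<beta> c d e f - X * vwp_sum q n (q\<^sup>2 * \<beta>) (q * c) (q * d) (q * e) (q * f) =
     (1 - \<tau>) * (\<Sum>k\<le>n. q ^ k * w k * p k - y * q ^ (n - k) * w k * p (Suc k))"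
    unfolding vwp_sum_def y(2) y_def[symmetric] w_def[symmetric] sum_distrib_left sum_subtractf[symmetric]
    by (rule sum.cong) (use termwise in \<open>auto simp: sum_subtractf\<close>)
  also have "(\<Sum>k\<le>n. q ^ k * w k * p k - y * q ^ (n - k) * w k * p (Suc k)) =
     (\<Sum>k\<le>Suc n. q ^ k * w k * p k) - (\<Sum>k\<le>n. y * q ^ (n - k) * w k * p (Suc k))"
    by (simp add: sum_subtractf last)
  also have "\<dots> = w 0 * p 0 + (\<Sum>k\<le>n. (q ^ Suc k * w (Suc k) - y * q ^ (n - k) * w k) * p (Suc k))"
    by (subst sum.atMost_Suc_shift) (simp add: sum_subtractf ring_distribs)
  finally have E: "Y * vwp_sum q n \<beta> c d e f - X * vwp_sum q n (q\<^sup>2 * \<beta>) (q * c) (q * d) (q * e) (q * f) =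
     (1 - \<tau>) * (w 0 * p 0 + (\<Sum>k\<le>n. (q ^ Suc k * w (Suc k) - y * q ^ (n - k) * w k) * p (Suc k)))" .
  \<comment> \<open>The product with index 0 receives a contribution from one summand only, and both weights are 1.\<close>
  have w0: "w 0 = 1" "vwp_weight q y (Suc n) 0 = 1"
    using qpoch_q_nonzero[OF assms(1)] by (simp_all add: w_def vwp_weight_def qbinom_def)
  have "vwp_sum q (Suc n) \<beta> c d e f = (1 - y * q ^ Suc n) * p 0 +
     (\<Sum>k\<le>n. (q ^ Suc k - y * q ^ (n - k)) * vwp_weight q y (Suc n) (Suc k) * p (Suc k))"
    unfolding vwp_sum_def y_def[symmetric] p_def
    by (subst sum.atMost_Suc_shift) (simp add: w0)
  also have "\<dots> = (1 - q ^ Suc n * y) * p 0 +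
     (\<Sum>k\<le>n. (1 - q ^ Suc n * y) * (q ^ Suc k * w (Suc k) - y * q ^ (n - k) * w k) * p (Suc k))"
    using vwp_weight_rec[OF assms(1) y(1), of n] assms(8) by (simp add: w_def y_def mult_ac)
  also have "\<dots> = (1 - q ^ Suc n * y) * (w 0 * p 0 + (\<Sum>k\<le>n. (q ^ Suc k * w (Suc k) - y * q ^ (n - k) * w k) * p (Suc k)))"
    by (simp only: w0 ring_distribs sum_distrib_left mult.assoc mult_1_left)
  finally show ?thesis
    using E unfolding X_def[symmetric] Y_def[symmetric] y_def[symmetric] by (simp only: mult_ac)
qed

section \<open>Symmetry of the cleared sum\<close>

text \<open>
  The shift sends \<open>\<beta>\<close> to \<open>q\<^sup>2 \<beta>\<close> while \<open>n\<close> drops by one, so excluding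
  \<open>\<beta> q\<^sup>j = 1\<close> for all \<open>j \<le> 2 n\<close> is a condition that survives the induction.
\<close>
lemma vwp_sum_eq_sym_rec:
  assumes "norm q \<noteq> 1" "q \<noteq> 0"
  shows "c \<noteq> 0 \<Longrightarrow> d \<noteq> 0 \<Longrightarrow> e \<noteq> 0 \<Longrightarrow> f \<noteq> 0 \<Longrightarrow> \<beta> \<noteq> 0 \<Longrightarrow>
    qpoch (q / (d / c)) q n \<noteq> 0 \<Longrightarrow> (\<And>j. j \<le> 2 * n \<Longrightarrow> \<beta> * q ^ j \<noteq> 1) \<Longrightarrow>
    vwp_sum q n \<beta> c d e f = qpoch (d / c) q (Suc n) * sym_rec q n \<beta> c d e f"
proof (induction n arbitrary: \<beta> c d e f)
  case 0
  then show ?case by (simp add: vwp_sum_def vwp_weight_def vwp_factor_def qbinom_def qpoch_Suc)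
next
  case (Suc n)
  have nz: "qpoch (q / (d / c)) q n \<noteq> 0"
    using Suc.prems(6) qpoch_nonzero_le by (meson le_SucI order_refl)
  have 1: "vwp_sum q n \<beta> c d e f = qpoch (d / c) q (Suc n) * sym_rec q n \<beta> c d e f"
    by (rule Suc.IH) (use Suc.prems nz in auto)
  have [simp]: "q * d / (q * c) = d / c" using assms by simp
  have 2: "vwp_sum q n (q\<^sup>2 * \<beta>) (q * c) (q * d) (q * e) (q * f) =
     qpoch (d / c) q (Suc n) * sym_rec q n (q\<^sup>2 * \<beta>) (q * c) (q * d) (q * e) (q * f)"
  proof -
    have "q\<^sup>2 * \<beta> * q ^ j \<noteq> 1" if "j \<le> 2 * n" for j
      using Suc.prems(7)[of "j + 2"] that by (simp add: power_add power2_eq_square mult_ac)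
    then show ?thesis
      using Suc.IH[of "q * c" "q * d" "q * e" "q * f" "q\<^sup>2 * \<beta>"] Suc.prems nz assms by simp
  qed
  have 3: "1 - \<beta> * q ^ n \<noteq> 0" using Suc.prems(7)[of n] by simp
  define Y where "Y = (1 - \<beta> * q ^ n / c) * (1 - \<beta> * q ^ n / d) * (1 - \<beta> * q ^ n / e) * (1 - \<beta> * q ^ n / f)"
  define X where "X = \<beta>\<^sup>2 * q ^ n / (c * d * e * f) * ((1 - c) * (1 - d) * (1 - e) * (1 - f))"
  have rec: "(1 - \<beta> * q ^ n) * sym_rec q (Suc n) \<beta> c d e f =
      Y * sym_rec q n \<beta> c d e f - X * sym_rec q n (q\<^sup>2 * \<beta>) (q * c) (q * d) (q * e) (q * f)"
    unfolding sym_rec.simps(2) X_def Y_def using 3 by (subst times_divide_eq_right) (rule nonzero_mult_div_cancel_left)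
  have "(1 - \<beta> * q ^ n) * vwp_sum q (Suc n) \<beta> c d e f =
     qpoch (d / c) q (Suc (Suc n)) * ((1 - \<beta> * q ^ n) * sym_rec q (Suc n) \<beta> c d e f)"
    unfolding vwp_sum_rec[OF assms Suc.prems(1-6)] X_def[symmetric] Y_def[symmetric] 1 2 rec qpoch_Suc[of _ _ "Suc n"]
    by (simp only: ring_distribs mult_ac)
  then have "(1 - \<beta> * q ^ n) * vwp_sum q (Suc n) \<beta> c d e f =
     (1 - \<beta> * q ^ n) * (qpoch (d / c) q (Suc (Suc n)) * sym_rec q (Suc n) \<beta> c d e f)"
    by (simp only: mult.left_commute)
  then show ?case using mult_left_cancel[OF 3] by blast
qed

text \<open>Adjacent transpositions, which generate all permutations of the four parameters.\<close>
lemma sym_rec_swap: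
  "sym_rec q n \<beta> d c e f = sym_rec q n \<beta> c d e f"
  "sym_rec q n \<beta> c e d f = sym_rec q n \<beta> c d e f"
  "sym_rec q n \<beta> c d f e = sym_rec q n \<beta> c d e f"
proof -
  show "sym_rec q n \<beta> d c e f = sym_rec q n \<beta> c d e f"
  proof (induction n arbitrary: \<beta> c d e f)
    case (Suc n)
    show ?case unfolding sym_rec.simps Suc.IH[of _ d c] Suc.IH[of _ "q * d" "q * c"] by (simp only: mult_ac)
  qed simp
  show "sym_rec q n \<beta> c e d f = sym_rec q n \<beta> c d e f"
  proof (induction n arbitrary: \<beta> c d e f)
    case (Suc n)
    show ?case unfolding sym_rec.simps Suc.IH[of _ c e d] Suc.IH[of _ _ "q * e" "q * d"] by (simp only: mult_ac)
  qed simp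
  show "sym_rec q n \<beta> c d f e = sym_rec q n \<beta> c d e f"
  proof (induction n arbitrary: \<beta> c d e f)
    case (Suc n)
    show ?case unfolding sym_rec.simps Suc.IH[of _ c d f e] Suc.IH[of _ _ _ "q * f" "q * e"] by (simp only: mult_ac)
  qed simp
qed

lemma isCont_eq_off_finite:
  fixes F G :: "complex \<Rightarrow> complex"
  assumes "finite S" "\<And>x. x \<notin> S \<Longrightarrow> F x = G x" "isCont F a" "isCont G a"
  shows "F a = G a"
proof -
  have "open (- (S - {a}))" using assms(1) by (meson finite_Diff finite_imp_closed open_Compl)
  then have "eventually (\<lambda>x. x \<in> - (S - {a})) (at a)"
    by (intro topological_tendstoD[OF tendsto_ident_at]) auto
  then have "eventually (\<lambda>x. F x = G x) (at a)"
    using eventually_neq_at_within[of a a UNIV] by eventually_elim (use assms(2) in auto)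
  then have "(G \<longlongrightarrow> F a) (at a)"
    using assms(3) unfolding isCont_def by (rule Lim_transform_eventually[rotated])
  then show ?thesis
    using assms(4) unfolding isCont_def using tendsto_unique[OF at_neq_bot] by blast
qed

lemma isCont_vwp_sum: "isCont (\<lambda>\<beta>. vwp_sum q n \<beta> c d e f) \<beta>\<^sub>0"
  if "c \<noteq> 0" "d \<noteq> 0" "e \<noteq> 0" "f \<noteq> 0"
  unfolding vwp_sum_def vwp_factor_def qpoch_def using that by (intro continuous_intros) auto

text \<open>
  Multiplying crosswise by the two shifted factorials eliminates the symmetric function, so both
  sides are continuous in \<open>\<beta>\<close> and the finitely many excluded values of \<open>\<beta>\<close> can be
  filled in. No division by \<open>(d/c; q)\<^sub>n\<^sub>+\<^sub>1\<close> takes place, so this also covers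
  the case where that factor, and with it the sum, vanishes.
\<close>
lemma vwp_sum_symmetric:
  assumes "norm q \<noteq> 1" "q \<noteq> 0" "c \<noteq> 0" "d \<noteq> 0" "e \<noteq> 0" "f \<noteq> 0"
    "c' \<noteq> 0" "d' \<noteq> 0" "e' \<noteq> 0" "f' \<noteq> 0"
    and "qpoch (q / (d / c)) q n \<noteq> 0" "qpoch (q / (d' / c')) q n \<noteq> 0"
    and U: "\<And>\<beta>. sym_rec q n \<beta> c' d' e' f' = sym_rec q n \<beta> c d e f"
  shows "vwp_sum q n \<beta> c d e f * qpoch (d' / c') q (Suc n) = vwp_sum q n \<beta> c' d' e' f' * qpoch (d / c) q (Suc n)"
proof -
  let ?S = "insert 0 ((\<lambda>j. 1 / q ^ j) ` {..2 * n})"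
  show ?thesis
  proof (rule isCont_eq_off_finite[of ?S "\<lambda>\<beta>. vwp_sum q n \<beta> c d e f * qpoch (d' / c') q (Suc n)"])
    fix \<gamma> assume g: "\<gamma> \<notin> ?S"
    then have "\<gamma> * q ^ j \<noteq> 1" if "j \<le> 2 * n" for j
      using that assms(2) by (auto simp: field_simps image_iff)
    then show "vwp_sum q n \<gamma> c d e f * qpoch (d' / c') q (Suc n) = vwp_sum q n \<gamma> c' d' e' f' * qpoch (d / c) q (Suc n)"
      using vwp_sum_eq_sym_rec[OF assms(1,2), of c d e f \<gamma> n] vwp_sum_eq_sym_rec[OF assms(1,2), of c' d' e' f' \<gamma> n] assms g
      by simp
  qed (use assms in \<open>auto intro!: continuous_intros isCont_vwp_sum\<close>)
qed

section \<open>From the very-well-poised series to the cleared sum\<close>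

text \<open>
  The four parameters containing the square root telescope to the very-well-poised factor.
\<close>
lemma qpoch_sqrt_ratio:
  assumes "s\<^sup>2 = a" "a \<noteq> 1" "qpoch s q k \<noteq> 0" "qpoch (- s) q k \<noteq> 0"
  shows "qpoch (q * s) q k * qpoch (- q * s) q k / (qpoch s q k * qpoch (- s) q k) =
    (1 - a * q ^ (2 * k)) / (1 - a)"
proof -
  have a: "(1 - s) * (1 - (- s)) = 1 - a"
    using assms(1) by (simp add: algebra_simps power2_eq_square)
  have "(1 - a) * (qpoch (q * s) q k * qpoch (- q * s) q k) =
     ((1 - s) * qpoch (s * q) q k) * ((1 - (- s)) * qpoch (- s * q) q k)"
    unfolding a[symmetric] by (simp add: mult_ac)
  also have "\<dots> = qpoch s q k * qpoch (- s) q k * ((1 - s * q ^ k) * (1 - (- s) * q ^ k))"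
    unfolding qpoch_shift by (simp only: mult_ac)
  also have "(1 - s * q ^ k) * (1 - (- s) * q ^ k) = 1 - a * q ^ (2 * k)"
    unfolding assms(1)[symmetric] by (simp add: algebra_simps power2_eq_square power_add mult_2_right)
  finally show ?thesis using assms by (simp add: divide_simps) (simp add: mult_ac)
qed

text \<open>
  Three numerator parameters, the base among them, and three denominator parameters contain
  \<open>q\<^sup>-\<^sup>n\<close>; reflecting all of them, the powers of \<open>q\<close> cancel and the remaining powers absorb the
  argument \<open>e f / b\<close> up to \<open>q\<^sup>-\<^sup>k\<close>, which the very-well-poised factor makes up for.
  The denominators which admissibility keeps away from zero are the factors of \<open>D\<close>, the
  quantity \<open>1 - y q\<^sup>n\<close> (from the base being different from 1) and \<open>(q/y; q)\<^sub>n\<close>. For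
  \<open>n = 0\<close> admissibility is void and does not prevent \<open>y = 1\<close>; hence \<open>n > 0\<close>.
\<close>
lemma W87_eq_vwp_sum:
  fixes n :: nat and q b c d e f :: complex
  assumes nz: "norm q \<noteq> 1" "q \<noteq> 0" "b \<noteq> 0" "c \<noteq> 0" "d \<noteq> 0" "e \<noteq> 0" "f \<noteq> 0" and n: "n > 0"
    and adm: "W87_admissible (q powi (- int n) * c / d) n (q powi (- int n) * c / b)
      (q * b / (d * e)) (q * b / (d * f)) c q"
  defines "D \<equiv> qpochs [d, q * b / d, q * b / (c * e), q * b / (c * f)] q n"
  shows "D \<noteq> 0" "1 - d / c * q ^ n \<noteq> 0" "qpoch (q / (d / c)) q n \<noteq> 0"
    "(1 - d / c * q ^ n) * D * W87 (q powi (- int n) * c / d) n (q powi (- int n) * c / b)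
        (q * b / (d * e)) (q * b / (d * f)) c q (e * f / b) = vwp_sum q n (q * b) c d e f"
proof -
  define \<nu> where "\<nu> = q powi (- int n)"
  have \<nu>: "\<nu> * q ^ n = 1" "\<nu> \<noteq> 0" using nz by (simp_all add: \<nu>_def power_int_minus power_int_of_nat)
  define a where "a = \<nu> * c / d"
  define s where "s = csqrt a"
  have s2: "s\<^sup>2 = a" by (simp add: s_def)
  have den: "W87_den s a n (\<nu> * c / b) (q * b / (d * e)) (q * b / (d * f)) c q =
     [q, s, - s, q / (d / c), q * b / d, \<nu> * (c * e / b), \<nu> * (c * f / b), \<nu> * (q / d)]"
    using \<nu> nz by (simp add: W87_den_def a_def field_simps)
  have "qpochs (W87_den s a n (\<nu> * c / b) (q * b / (d * e)) (q * b / (d * f)) c q) q n \<noteq> 0"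
    unfolding s_def a_def \<nu>_def by (rule W87_admissible_imp_nonzero[OF nz(2) adm]) simp
  then have dnz: "qpoch s q n \<noteq> 0" "qpoch (- s) q n \<noteq> 0" "qpoch (q / (d / c)) q n \<noteq> 0"
    "qpoch (q * b / d) q n \<noteq> 0" "qpoch (\<nu> * (c * e / b)) q n \<noteq> 0"
    "qpoch (\<nu> * (c * f / b)) q n \<noteq> 0" "qpoch (\<nu> * (q / d)) q n \<noteq> 0"
    unfolding den by (simp_all add: qpochs_def)
  show "qpoch (q / (d / c)) q n \<noteq> 0" by fact
  have "s * q ^ 0 \<noteq> 1" "(- s) * q ^ 0 \<noteq> 1"
    using dnz(1,2) n unfolding qpoch_nonzero_iff by blast+
  then have a1: "a \<noteq> 1" using s2 by (metis mult.right_neutral power_0 power2_eq_1_iff minus_equation_iff)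
  have ay: "1 - a = - a * (1 - d / c * q ^ n)" using \<nu> nz by (simp add: a_def field_simps)
  show yn: "1 - d / c * q ^ n \<noteq> 0" using a1 ay by auto
  define \<rho> where "\<rho> k = (\<Prod>j<k. q ^ (n - j))" for k
  have reflect: "qpoch (q ^ (n - k + 1) / z) q k = \<rho> k * (- 1 / z) ^ k * qpoch (\<nu> * z) q k"
    if "k \<le> n" "z \<noteq> 0" for k z
    using qpoch_reflect[OF nz(2) that(2), of "n - k" k] that by (simp add: \<rho>_def \<nu>_def)
  have split: "qpoch (q / z) q n = qpoch (q / z) q (n - k) * (\<rho> k * (- 1 / z) ^ k * qpoch (\<nu> * z) q k)"
    if "k \<le> n" "z \<noteq> 0" for k z
    using qpoch_add[of "q / z" q "n - k" k] reflect[OF that] that by simp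
  have \<rho>: "\<rho> k \<noteq> 0" for k using nz by (simp add: \<rho>_def)
  have z: "c * e / b \<noteq> 0" "c * f / b \<noteq> 0" "q / d \<noteq> 0" "c / d \<noteq> 0" "c / b \<noteq> 0" using nz by auto
  have zi: "q / (c * e / b) = q * b / (c * e)" "q / (c * f / b) = q * b / (c * f)" "q / (q / d) = d"
    using nz by simp_all
  show "D \<noteq> 0"
    using dnz \<rho>[of n] split[OF order_refl z(1)] split[OF order_refl z(2)] split[OF order_refl z(3)] nz
    unfolding zi by (simp add: D_def qpochs_def)
  have termwise: "(1 - d / c * q ^ n) * D *
      (qpochs (W87_num s a n (\<nu> * c / b) (q * b / (d * e)) (q * b / (d * f)) c q) q k /
       qpochs (W87_den s a n (\<nu> * c / b) (q * b / (d * e)) (q * b / (d * f)) c q) q k * (e * f / b) ^ k) =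
      (q ^ k - d / c * q ^ (n - k)) * vwp_weight q (d / c) n k * vwp_factor q (q * b) c d e f k (n - k)"
    if k: "k \<le> n" for k
  proof -
    note dk = dnz[THEN qpoch_nonzero_le, OF k]
    define g3 g4 g5 \<beta>1 X where g: "g3 = qpoch (\<nu> * (c * e / b)) q k" "g4 = qpoch (\<nu> * (c * f / b)) q k"
      "g5 = qpoch (\<nu> * (q / d)) q k" "\<beta>1 = qpoch (q * b / d) q k" "X = qpoch (q / (d / c)) q k"
    have gnz: "g3 \<noteq> 0" "g4 \<noteq> 0" "g5 \<noteq> 0" "\<beta>1 \<noteq> 0" "X \<noteq> 0" using dk unfolding g by simp_all
    define Q where "Q = qpoch q q k"
    have Q: "Q \<noteq> 0" "qpoch q q (n - k) \<noteq> 0" using qpoch_q_nonzero[OF nz(1)] by (simp_all add: Q_def)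
    define a0 a1 a2 where a: "a0 = qpoch (\<nu> * (c / d)) q k" "a1 = qpoch (\<nu> * 1) q k" "a2 = qpoch (\<nu> * (c / b)) q k"
    define p where "p = qpoch c q k * qpoch (q * b / (d * e)) q k * qpoch (q * b / (d * f)) q k"
    define m where "m = n - k"
    define r where "r = qpoch d q m * qpoch (q * b / (c * e)) q m * qpoch (q * b / (c * f)) q m * qpoch (q ^ k * (q * b) / d) q m"
    have T: "qpochs (W87_num s a n (\<nu> * c / b) (q * b / (d * e)) (q * b / (d * f)) c q) q k /
       qpochs (W87_den s a n (\<nu> * c / b) (q * b / (d * e)) (q * b / (d * f)) c q) q k =
       (qpoch (q * s) q k * qpoch (- q * s) q k / (qpoch s q k * qpoch (- s) q k)) *
       (a0 * a1 * a2 * p / (Q * X * \<beta>1 * g3 * g4 * g5))"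
      unfolding den W87_num_def qpochs_def
      by (simp add: a a_def p_def g Q_def \<nu>_def mult_ac)
    have D: "D = (\<rho> k * (- d / q) ^ k * g5) * \<beta>1 * (\<rho> k * (- b / (c * e)) ^ k * g3) *
       (\<rho> k * (- b / (c * f)) ^ k * g4) * r"
    proof -
      have "qpoch (q * b / d) q n = \<beta>1 * qpoch (q ^ k * (q * b) / d) q m"
        using qpoch_add[of "q * b / d" q k m] k by (simp add: g m_def mult_ac)
      moreover note split[OF k z(1)] split[OF k z(2)] split[OF k z(3)]
      ultimately show ?thesis
        unfolding zi by (simp add: D_def qpochs_def r_def g m_def mult_ac)
    qed
    have V: "(1 - d / c * q ^ n) * ((1 - a * q ^ (2 * k)) / (1 - a)) = q ^ k * (q ^ k - d / c * q ^ m)"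
    proof -
      have qn: "q ^ n = q ^ k * q ^ m" using k by (simp add: m_def flip: power_add)
      have gen: "u * ((1 - a * x) / (- a * u)) = x - 1 / a" if "u \<noteq> 0" "a \<noteq> 0" for u x
        using that by (simp add: field_simps)
      have "a \<noteq> 0" using \<nu> nz by (simp add: a_def)
      then have "(1 - d / c * q ^ n) * ((1 - a * q ^ (2 * k)) / (1 - a)) = q ^ (2 * k) - 1 / a"
        unfolding ay using yn by (intro gen)
      also have "1 / a = d / c * q ^ n" using \<nu> nz by (simp add: a_def field_simps)
      finally show ?thesis by (simp add: qn algebra_simps mult_2_right power_add)
    qed
    have pw: "(- d / q) ^ k * (- b / (c * e)) ^ k * (- b / (c * f)) ^ k * (e * f / b) ^ k * q ^ k =
        (- (d / c)) ^ k * (- 1) ^ k * (- b / c) ^ k"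
      unfolding power_mult_distrib[symmetric] using nz by (intro arg_cong[of _ _ "\<lambda>t. t ^ k"]) (simp add: field_simps)
    have w: "vwp_weight q (d / c) n k = (\<rho> k * (- 1) ^ k * a1 / Q) * (\<rho> k * (- (d / c)) ^ k * a0) / X"
    proof -
      have "qpoch q q n = qpoch q q m * (\<rho> k * (- 1) ^ k * a1)"
        using split[OF k, of 1] by (simp add: m_def a)
      moreover have "qpoch (q ^ (m + 1) * (d / c)) q k = \<rho> k * (- (d / c)) ^ k * a0"
        using reflect[OF k z(4)] by (simp add: m_def a)
      ultimately show ?thesis using k Q unfolding vwp_weight_def qbinom_def by (simp add: g Q_def m_def)
    qed
    have "qpoch (q ^ m * (q * b) / c) q k = \<rho> k * (- b / c) ^ k * a2"
      using reflect[OF k z(5)] by (simp add: m_def a mult_ac)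
    then have P: "vwp_factor q (q * b) c d e f k m = p * (\<rho> k * (- b / c) ^ k * a2) * r"
      by (simp add: vwp_factor_def p_def r_def)
    have "(1 - d / c * q ^ n) * D *
      (qpochs (W87_num s a n (\<nu> * c / b) (q * b / (d * e)) (q * b / (d * f)) c q) q k /
       qpochs (W87_den s a n (\<nu> * c / b) (q * b / (d * e)) (q * b / (d * f)) c q) q k * (e * f / b) ^ k) =
      ((1 - d / c * q ^ n) * ((1 - a * q ^ (2 * k)) / (1 - a))) *
      (D * (a0 * a1 * a2 * p / (Q * X * \<beta>1 * g3 * g4 * g5)) * (e * f / b) ^ k)"
      unfolding T qpoch_sqrt_ratio[OF s2 a1 dk(1,2)] by (simp only: mult_ac)
    also have "D * (a0 * a1 * a2 * p / (Q * X * \<beta>1 * g3 * g4 * g5)) * (e * f / b) ^ k =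
       \<rho> k * \<rho> k * \<rho> k * r * (a0 * a1 * a2 * p / (Q * X)) *
       ((- d / q) ^ k * (- b / (c * e)) ^ k * (- b / (c * f)) ^ k * (e * f / b) ^ k)"
      unfolding D using gnz by simp
    also have "((1 - d / c * q ^ n) * ((1 - a * q ^ (2 * k)) / (1 - a))) *
       (\<rho> k * \<rho> k * \<rho> k * r * (a0 * a1 * a2 * p / (Q * X)) *
       ((- d / q) ^ k * (- b / (c * e)) ^ k * (- b / (c * f)) ^ k * (e * f / b) ^ k)) =
       (q ^ k - d / c * q ^ m) * (\<rho> k * \<rho> k * \<rho> k * r * (a0 * a1 * a2 * p / (Q * X)) *
       ((- d / q) ^ k * (- b / (c * e)) ^ k * (- b / (c * f)) ^ k * (e * f / b) ^ k * q ^ k))"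
      unfolding V by (simp only: mult_ac)
    also have "\<dots> = (q ^ k - d / c * q ^ (n - k)) * vwp_weight q (d / c) n k * vwp_factor q (q * b) c d e f k (n - k)"
      unfolding pw w P m_def[symmetric] by (simp only: mult_ac times_divide_eq_left times_divide_eq_right divide_divide_eq_left)
    finally show ?thesis .
  qed
  show "(1 - d / c * q ^ n) * D * W87 (q powi (- int n) * c / d) n (q powi (- int n) * c / b)
        (q * b / (d * e)) (q * b / (d * f)) c q (e * f / b) = vwp_sum q n (q * b) c d e f"
    unfolding \<nu>_def[symmetric] a_def[symmetric] W87_def vwp_sum_def sum_distrib_left s_def[symmetric]
    by (rule sum.cong) (use termwise in auto)
qed

text \<open>
  The common form of the eleven transformations: the normalised series is the same for any two
  arrangements of the four parameters. The nonvanishing of both normalising products is a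
  consequence of admissibility, and it is what allows their common factors to be cancelled.
\<close>
lemma W87_transform:
  fixes n :: nat and q b c d e f c' d' e' f' :: complex
  assumes nz: "norm q \<noteq> 1" "q \<noteq> 0" "b \<noteq> 0" "c \<noteq> 0" "d \<noteq> 0" "e \<noteq> 0" "f \<noteq> 0"
    "c' \<noteq> 0" "d' \<noteq> 0" "e' \<noteq> 0" "f' \<noteq> 0"
    and adm: "W87_admissible (q powi (- int n) * c / d) n (q powi (- int n) * c / b)
      (q * b / (d * e)) (q * b / (d * f)) c q"
    and adm': "W87_admissible (q powi (- int n) * c' / d') n (q powi (- int n) * c' / b)
      (q * b / (d' * e')) (q * b / (d' * f')) c' q"
    and U: "\<And>\<beta>. sym_rec q n \<beta> c' d' e' f' = sym_rec q n \<beta> c d e f"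
    and nz': "qpoch (d' / c') q n \<noteq> 0"
  shows "W87 (q powi (- int n) * c / d) n (q powi (- int n) * c / b)
        (q * b / (d * e)) (q * b / (d * f)) c q (e * f / b) =
      qpochs [d', q * b / d', q * b / (c' * e'), q * b / (c' * f')] q n * qpoch (d / c) q n /
      (qpochs [d, q * b / d, q * b / (c * e), q * b / (c * f)] q n * qpoch (d' / c') q n) *
      W87 (q powi (- int n) * c' / d') n (q powi (- int n) * c' / b)
        (q * b / (d' * e')) (q * b / (d' * f')) c' q (e' * f' / b)"
    (is "?W = ?D' * _ / (?D * _) * ?W'")
    and "qpochs [d, q * b / d, q * b / (c * e), q * b / (c * f)] q n \<noteq> 0"
    and "qpochs [d', q * b / d', q * b / (c' * e'), q * b / (c' * f')] q n \<noteq> 0"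
proof -
  have "?W = ?D' * qpoch (d / c) q n / (?D * qpoch (d' / c') q n) * ?W' \<and> ?D \<noteq> 0 \<and> ?D' \<noteq> 0"
  proof (cases "n = 0")
    case True
    then show ?thesis by (simp add: W87_def qpochs_def W87_num_def W87_den_def)
  next
    case False
    then have n: "n > 0" by simp
    note W = W87_eq_vwp_sum[OF nz(1-7) n adm] and W' = W87_eq_vwp_sum[OF nz(1-3,8-11) n adm']
    have "vwp_sum q n (q * b) c d e f * qpoch (d' / c') q (Suc n) = vwp_sum q n (q * b) c' d' e' f' * qpoch (d / c) q (Suc n)"
      by (rule vwp_sum_symmetric) (use nz W(3) W'(3) U in auto)
    then have "(1 - d / c * q ^ n) * (1 - d' / c' * q ^ n) * (?D * ?W * qpoch (d' / c') q n) =
       (1 - d / c * q ^ n) * (1 - d' / c' * q ^ n) * (?D' * ?W' * qpoch (d / c) q n)"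
      unfolding W(4)[symmetric] W'(4)[symmetric] qpoch_Suc by (simp only: mult_ac)
    moreover have "(1 - d / c * q ^ n) * (1 - d' / c' * q ^ n) \<noteq> 0"
      using W(2) W'(2) by (simp only: mult_eq_0_iff) blast
    ultimately have "?D * ?W * qpoch (d' / c') q n = ?D' * ?W' * qpoch (d / c) q n"
      using mult_left_cancel by blast
    moreover have "w = x' * y / (x * z) * w'" if "x * w * z = x' * w' * y" "x \<noteq> 0" "z \<noteq> 0"
      for w w' x x' y z :: complex
      using that by (simp add: field_simps)
    ultimately show ?thesis using W(1) W'(1) nz' by blast
  qed
  then show "?W = ?D' * qpoch (d / c) q n / (?D * qpoch (d' / c') q n) * ?W'" "?D \<noteq> 0" "?D' \<noteq> 0" by auto
qed

theorem corollary3p5: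
  fixes n :: nat and q b c d e f :: complex
  assumes "q \<noteq> 0" "b \<noteq> 0" "c \<noteq> 0" "d \<noteq> 0" "e \<noteq> 0" "f \<noteq> 0"
    and "norm q \<noteq> 1"
    and "W87_admissible (q powi (- int n) * c / d) n (q powi (- int n) * c / b) (q * b / (d * e)) (q * b / (d * f)) c q"
  shows
   "(qpochs [q * b / (c * e), q * b / (c * f), q * b / d, c / d, d] q n \<noteq> 0 \<longrightarrow>
      W87_admissible (q powi (- int n) * d / c) n (q powi (- int n) * d / b) (q * b / (c * e)) (q * b / (c * f)) d q \<longrightarrow>
      W87 (q powi (- int n) * c / d) n (q powi (- int n) * c / b) (q * b / (d * e)) (q * b / (d * f)) c q (e * f / b) =
        qpochs [q * b / (d * e), q * b / (d * f), q * b / c, d / c, c] q n / qpochs [q * b / (c * e), q * b / (c * f), q * b / d, c / d, d] q n *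
        W87 (q powi (- int n) * d / c) n (q powi (- int n) * d / b) (q * b / (c * e)) (q * b / (c * f)) d q (e * f / b)) \<and>
    (qpochs [q * b / (c * e), q * b / d, e / c, d] q n \<noteq> 0 \<longrightarrow>
      W87_admissible (q powi (- int n) * c / e) n (q powi (- int n) * c / b) (q * b / (e * d)) (q * b / (e * f)) c q \<longrightarrow>
      W87 (q powi (- int n) * c / d) n (q powi (- int n) * c / b) (q * b / (d * e)) (q * b / (d * f)) c q (e * f / b) =
        qpochs [q * b / (c * d), q * b / e, d / c, e] q n / qpochs [q * b / (c * e), q * b / d, e / c, d] q n *
        W87 (q powi (- int n) * c / e) n (q powi (- int n) * c / b) (q * b / (e * d)) (q * b / (e * f)) c q (d * f / b)) \<and>
    (qpochs [q * b / (c * e), q * b / (c * f), q * b / d, c / e, d] q n \<noteq> 0 \<longrightarrow>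
      W87_admissible (q powi (- int n) * e / c) n (q powi (- int n) * e / b) (q * b / (c * d)) (q * b / (c * f)) e q \<longrightarrow>
      W87 (q powi (- int n) * c / d) n (q powi (- int n) * c / b) (q * b / (d * e)) (q * b / (d * f)) c q (e * f / b) =
        qpochs [q * b / (e * d), q * b / (e * f), q * b / c, d / c, c] q n / qpochs [q * b / (c * e), q * b / (c * f), q * b / d, c / e, d] q n *
        W87 (q powi (- int n) * e / c) n (q powi (- int n) * e / b) (q * b / (c * d)) (q * b / (c * f)) e q (d * f / b)) \<and>
    (qpochs [q * b / (c * f), q * b / d, f / c, d] q n \<noteq> 0 \<longrightarrow>
      W87_admissible (q powi (- int n) * c / f) n (q powi (- int n) * c / b) (q * b / (e * f)) (q * b / (d * f)) c q \<longrightarrow>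
      W87 (q powi (- int n) * c / d) n (q powi (- int n) * c / b) (q * b / (d * e)) (q * b / (d * f)) c q (e * f / b) =
        qpochs [q * b / (c * d), q * b / f, d / c, f] q n / qpochs [q * b / (c * f), q * b / d, f / c, d] q n *
        W87 (q powi (- int n) * c / f) n (q powi (- int n) * c / b) (q * b / (e * f)) (q * b / (d * f)) c q (d * e / b)) \<and>
    (qpochs [q * b / (c * e), q * b / (c * f), q * b / d, c / f, d] q n \<noteq> 0 \<longrightarrow>
      W87_admissible (q powi (- int n) * f / c) n (q powi (- int n) * f / b) (q * b / (c * d)) (q * b / (c * e)) f q \<longrightarrow>
      W87 (q powi (- int n) * c / d) n (q powi (- int n) * c / b) (q * b / (d * e)) (q * b / (d * f)) c q (e * f / b) =
        qpochs [q * b / (f * d), q * b / (f * e), q * b / c, d / c, c] q n / qpochs [q * b / (c * e), q * b / (c * f), q * b / d, c / f, d] q n *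
        W87 (q powi (- int n) * f / c) n (q powi (- int n) * f / b) (q * b / (c * d)) (q * b / (c * e)) f q (d * e / b)) \<and>
    (qpochs [q * b / (c * f), d / e] q n \<noteq> 0 \<longrightarrow>
      W87_admissible (q powi (- int n) * e / d) n (q powi (- int n) * e / b) (q * b / (d * c)) (q * b / (d * f)) e q \<longrightarrow>
      W87 (q powi (- int n) * c / d) n (q powi (- int n) * c / b) (q * b / (d * e)) (q * b / (d * f)) c q (e * f / b) =
        qpochs [q * b / (e * f), d / c] q n / qpochs [q * b / (c * f), d / e] q n *
        W87 (q powi (- int n) * e / d) n (q powi (- int n) * e / b) (q * b / (d * c)) (q * b / (d * f)) e q (c * f / b)) \<and>
    (qpochs [q * b / (c * e), q * b / (c * f), q * b / d, e / d, d] q n \<noteq> 0 \<longrightarrow>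
      W87_admissible (q powi (- int n) * d / e) n (q powi (- int n) * d / b) (q * b / (e * c)) (q * b / (e * f)) d q \<longrightarrow>
      W87 (q powi (- int n) * c / d) n (q powi (- int n) * c / b) (q * b / (d * e)) (q * b / (d * f)) c q (e * f / b) =
        qpochs [q * b / (d * c), q * b / (d * f), q * b / e, d / c, e] q n / qpochs [q * b / (c * e), q * b / (c * f), q * b / d, e / d, d] q n *
        W87 (q powi (- int n) * d / e) n (q powi (- int n) * d / b) (q * b / (e * c)) (q * b / (e * f)) d q (c * f / b)) \<and>
    (qpochs [q * b / (c * e), d / f] q n \<noteq> 0 \<longrightarrow>
      W87_admissible (q powi (- int n) * f / d) n (q powi (- int n) * f / b) (q * b / (d * c)) (q * b / (d * e)) f q \<longrightarrow>
      W87 (q powi (- int n) * c / d) n (q powi (- int n) * c / b) (q * b / (d * e)) (q * b / (d * f)) c q (e * f / b) =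
        qpochs [q * b / (e * f), d / c] q n / qpochs [q * b / (c * e), d / f] q n *
        W87 (q powi (- int n) * f / d) n (q powi (- int n) * f / b) (q * b / (d * c)) (q * b / (d * e)) f q (c * e / b)) \<and>
    (qpochs [q * b / (c * e), q * b / (c * f), q * b / d, f / d, d] q n \<noteq> 0 \<longrightarrow>
      W87_admissible (q powi (- int n) * d / f) n (q powi (- int n) * d / b) (q * b / (f * c)) (q * b / (f * e)) d q \<longrightarrow>
      W87 (q powi (- int n) * c / d) n (q powi (- int n) * c / b) (q * b / (d * e)) (q * b / (d * f)) c q (e * f / b) =
        qpochs [q * b / (d * e), q * b / (d * c), q * b / f, d / c, f] q n / qpochs [q * b / (c * e), q * b / (c * f), q * b / d, f / d, d] q n *
        W87 (q powi (- int n) * d / f) n (q powi (- int n) * d / b) (q * b / (f * c)) (q * b / (f * e)) d q (c * e / b)) \<and>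
    (qpochs [q * b / (c * f), q * b / d, f / e, d] q n \<noteq> 0 \<longrightarrow>
      W87_admissible (q powi (- int n) * e / f) n (q powi (- int n) * e / b) (q * b / (f * c)) (q * b / (f * d)) e q \<longrightarrow>
      W87 (q powi (- int n) * c / d) n (q powi (- int n) * c / b) (q * b / (d * e)) (q * b / (d * f)) c q (e * f / b) =
        qpochs [q * b / (e * d), q * b / f, d / c, f] q n / qpochs [q * b / (c * f), q * b / d, f / e, d] q n *
        W87 (q powi (- int n) * e / f) n (q powi (- int n) * e / b) (q * b / (f * c)) (q * b / (f * d)) e q (c * d / b)) \<and>
    (qpochs [q * b / (c * e), q * b / d, e / f, d] q n \<noteq> 0 \<longrightarrow>
      W87_admissible (q powi (- int n) * f / e) n (q powi (- int n) * f / b) (q * b / (e * c)) (q * b / (e * d)) f q \<longrightarrow>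
      W87 (q powi (- int n) * c / d) n (q powi (- int n) * c / b) (q * b / (d * e)) (q * b / (d * f)) c q (e * f / b) =
        qpochs [q * b / (d * f), q * b / e, d / c, e] q n / qpochs [q * b / (c * e), q * b / d, e / f, d] q n *
        W87 (q powi (- int n) * f / e) n (q powi (- int n) * f / b) (q * b / (e * c)) (q * b / (e * d)) f q (c * d / b))"
proof -
  note transform = W87_transform[OF assms(7,1-6) _ _ _ _ assms(8)]
  have perm:
    "sym_rec q n \<beta> d c e f = sym_rec q n \<beta> c d e f"
    "sym_rec q n \<beta> c e d f = sym_rec q n \<beta> c d e f"
    "sym_rec q n \<beta> e c d f = sym_rec q n \<beta> c d e f"
    "sym_rec q n \<beta> c f e d = sym_rec q n \<beta> c d e f"
    "sym_rec q n \<beta> f c d e = sym_rec q n \<beta> c d e f"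
    "sym_rec q n \<beta> e d c f = sym_rec q n \<beta> c d e f"
    "sym_rec q n \<beta> d e c f = sym_rec q n \<beta> c d e f"
    "sym_rec q n \<beta> f d c e = sym_rec q n \<beta> c d e f"
    "sym_rec q n \<beta> d f c e = sym_rec q n \<beta> c d e f"
    "sym_rec q n \<beta> e f c d = sym_rec q n \<beta> c d e f"
    "sym_rec q n \<beta> f e c d = sym_rec q n \<beta> c d e f"
    for \<beta> by (simp_all add: sym_rec_swap)
  show ?thesis
  proof (intro conjI impI, goal_cases)
    case 1
    then have "qpoch (c / d) q n \<noteq> 0" by (simp add: qpochs_def)
    note T = transform[OF assms(4,3,5,6) 1(2) perm(1) this]
    show ?case unfolding T(1) using T(2,3) 1(1) by (simp add: qpochs_def mult_ac)
  next
    case 2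
    then have "qpoch (e / c) q n \<noteq> 0" by (simp add: qpochs_def)
    note T = transform[OF assms(3,5,4,6) 2(2) perm(2) this]
    show ?case unfolding T(1) using T(2,3) 2(1) by (simp add: qpochs_def mult_ac)
  next
    case 3
    then have "qpoch (c / e) q n \<noteq> 0" by (simp add: qpochs_def)
    note T = transform[OF assms(5,3,4,6) 3(2) perm(3) this]
    show ?case unfolding T(1) using T(2,3) 3(1) by (simp add: qpochs_def mult_ac)
  next
    case 4
    then have "qpoch (f / c) q n \<noteq> 0" by (simp add: qpochs_def)
    \<comment> \<open>Here the denominators of two parameters have their factors in the other order.\<close>
    note T = transform[OF assms(3,6,5,4) 4(2)[unfolded mult.commute[of e f] mult.commute[of d f]] perm(4) this]
    show ?case unfolding T(1) using T(2,3) 4(1) by (simp add: qpochs_def mult_ac)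
  next
    case 5
    then have "qpoch (c / f) q n \<noteq> 0" by (simp add: qpochs_def)
    note T = transform[OF assms(6,3,4,5) 5(2) perm(5) this]
    show ?case unfolding T(1) using T(2,3) 5(1) by (simp add: qpochs_def mult_ac)
  next
    case 6
    then have "qpoch (d / e) q n \<noteq> 0" by (simp add: qpochs_def)
    note T = transform[OF assms(5,4,3,6) 6(2) perm(6) this]
    show ?case unfolding T(1) using T(2,3) 6(1) by (simp add: qpochs_def mult_ac)
  next
    case 7
    then have "qpoch (e / d) q n \<noteq> 0" by (simp add: qpochs_def)
    note T = transform[OF assms(4,5,3,6) 7(2) perm(7) this]
    show ?case unfolding T(1) using T(2,3) 7(1) by (simp add: qpochs_def mult_ac)
  next
    case 8
    then have "qpoch (d / f) q n \<noteq> 0" by (simp add: qpochs_def)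
    note T = transform[OF assms(6,4,3,5) 8(2) perm(8) this]
    show ?case unfolding T(1) using T(2,3) 8(1) by (simp add: qpochs_def mult_ac)
  next
    case 9
    then have "qpoch (f / d) q n \<noteq> 0" by (simp add: qpochs_def)
    note T = transform[OF assms(4,6,3,5) 9(2) perm(9) this]
    show ?case unfolding T(1) using T(2,3) 9(1) by (simp add: qpochs_def mult_ac)
  next
    case 10
    then have "qpoch (f / e) q n \<noteq> 0" by (simp add: qpochs_def)
    note T = transform[OF assms(5,6,3,4) 10(2) perm(10) this]
    show ?case unfolding T(1) using T(2,3) 10(1) by (simp add: qpochs_def mult_ac)
  next
    case 11
    then have "qpoch (e / f) q n \<noteq> 0" by (simp add: qpochs_def)
    note T = transform[OF assms(6,5,3,4) 11(2) perm(11) this]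
    show ?case unfolding T(1) using T(2,3) 11(1) by (simp add: qpochs_def mult_ac)
  qed
qed

end
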